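(* For any integer $\ell\geq 2$ there is a constant $C=C(\ell)$ such that the following holds. Let $G$ be a graph with at most $n$ vertices and at least $Cn^{3/2+1/\ell}$ edges, with a proper edge-colouring that uses at most $n$ colours. Then $G$ has two vertex-disjoint rainbow cycles of length $2\ell$ such that the set of colours used on the two cycles is the same.
   Context: A proper edge-colouring assigns distinct colours to edges sharing a vertex. A cycle is rainbow if all its edges have distinct colours. *)

theory Defs
  imports Complex_Main
begin

definition simple_graph :: "'a set \<Rightarrow> 'a set set \<Rightarrow> bool" where
  "simple_graph V E \<longleftrightarrow> finite V \<and> (\<forall>e\<in>E. e \<subseteq> V \<and> card e = 2)"

(* A colouring is a total function on vertex sets; only its values on E matter. *)
definition proper_edge_colouring :: "'a set set \<Rightarrow> ('a set \<Rightarrow> 'b) \<Rightarrow> bool" where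
  "proper_edge_colouring E c \<longleftrightarrow>
     (\<forall>e\<in>E. \<forall>f\<in>E. e \<noteq> f \<and> e \<inter> f \<noteq> {} \<longrightarrow> c e \<noteq> c f)"

(* A cycle is given by the cyclic sequence of its vertices. Its length, the number of
   edges, equals the length of the list because the vertices are distinct and there
   are at least three of them. *)
definition cycle_edges :: "'a list \<Rightarrow> 'a set set" where
  "cycle_edges p = {{p ! i, p ! (Suc i mod length p)} | i. i < length p}"

definition is_cycle :: "'a set \<Rightarrow> 'a set set \<Rightarrow> 'a list \<Rightarrow> bool" where
  "is_cycle V E p \<longleftrightarrow>
     3 \<le> length p \<and> distinct p \<and> set p \<subseteq> V \<and> cycle_edges p \<subseteq> E"

definition rainbow_cycle :: "'a set \<Rightarrow> 'a set set \<Rightarrow> ('a set \<Rightarrow> 'b) \<Rightarrow> 'a list \<Rightarrow> bool" where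
  "rainbow_cycle V E c p \<longleftrightarrow> is_cycle V E p \<and> inj_on c (cycle_edges p)"

end

(* Consider the auxiliary graph on pairs of vertices in which (u, v) and (u', v') are adjacent when uu'
   and vv' are distinct edges of the same colour. By Cauchy-Schwarz over the colour classes it has average
   degree of order C^2 N^(1/l) with N = n^2, so it has a nonempty subgraph of minimum degree d of that order.
   A closed 2l-walk in it whose colours are distinct and whose pairs are disjoint gives the two cycles.

   Such a walk is found by weighting each closed walk by the product of the reciprocal degrees of its
   vertices, so that the total weight T(2l) is a trace of the random walk; this is a weighted form of a
   method of Janzer that needs a lower bound on the degrees but no upper bound. Given a walk x_1, ..., x_l,
   only boundedly many neighbours x_0 of x_1 conflict with it, and AM-GM bounds the weight of the closed
   walks with a prescribed conflict by a multiple of sqrt (T(2l) T(2l-2) / d). As T is log-convex with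
   T(0) <= N and T(2l) >= 1, we have T(2l-2) <= N^(1/l) T(2l), so that for large C the conflicting walks
   have less than the total weight. *)
theory Submission
  imports Defs "HOL-Analysis.Convex"
begin

section \<open>Weighted walks in graphs of large minimum degree\<close>

locale min_degree_graph =
  fixes V :: "'v set" and adj :: "'v \<Rightarrow> 'v \<Rightarrow> bool" and \<delta> :: real
  assumes finite_V: "finite V"
    and adj_sym: "adj x y \<Longrightarrow> adj y x"
    and min_degree: "x \<in> V \<Longrightarrow> \<delta> \<le> real (card {y \<in> V. adj x y})"
    and min_degree_pos: "0 < \<delta>"
    and V_nonempty: "V \<noteq> {}"
begin

definition nbrs :: "'v \<Rightarrow> 'v set" where
  "nbrs x = {y \<in> V. adj x y}"

definition dg :: "'v \<Rightarrow> real" where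
  "dg x = real (card (nbrs x))"

text \<open>\<open>K k x y\<close> is the total weight of the walks with \<open>k\<close> edges from \<open>x\<close> to \<open>y\<close>, where a walk
  is weighted by the product of the reciprocal degrees of all its \<open>k + 1\<close> vertices. In terms of the
  simple random walk it is the \<open>k\<close>-step transition probability divided by \<open>dg y\<close>, which
  makes it symmetric. \<open>T m\<close> is the trace of the \<open>m\<close>-step transition matrix.\<close>

fun K :: "nat \<Rightarrow> 'v \<Rightarrow> 'v \<Rightarrow> real" where
  "K 0 x y = (if x = y then 1 / dg x else 0)"
| "K (Suc k) x y = (\<Sum>u\<in>nbrs x. K k u y) / dg x"

definition T :: "nat \<Rightarrow> real" where
  "T m = (\<Sum>x\<in>V. dg x * K m x x)"

lemma finite_nbrs [simp]: "finite (nbrs x)"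
  using finite_V by (simp add: nbrs_def)

lemma nbrs_sub: "nbrs x \<subseteq> V"
  by (auto simp: nbrs_def)

lemma in_nbrs_sym: "x \<in> V \<Longrightarrow> y \<in> nbrs x \<Longrightarrow> x \<in> nbrs y"
  using adj_sym by (auto simp: nbrs_def)

lemma dg_ge: "x \<in> V \<Longrightarrow> \<delta> \<le> dg x"
  using min_degree by (simp add: dg_def nbrs_def)

lemma dg_pos: "x \<in> V \<Longrightarrow> 0 < dg x"
  using dg_ge min_degree_pos by fastforce

lemma dg_nonneg [simp]: "0 \<le> dg x"
  by (simp add: dg_def)

lemma K_nonneg [simp]: "0 \<le> K k x y"
  by (induction k arbitrary: x) (auto intro!: sum_nonneg divide_nonneg_nonneg)

section \<open>Convolution and reversibility of the walk kernel \<open>K\<close>\<close>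

lemma sum_nbrs_swap:
  "(\<Sum>x\<in>V. \<Sum>y\<in>nbrs x. f x y) = (\<Sum>y\<in>V. \<Sum>x\<in>nbrs y. f x y)"
proof -
  have "(\<Sum>x\<in>V. \<Sum>y\<in>nbrs x. f x y) = (\<Sum>x\<in>V. \<Sum>y\<in>{y\<in>V. adj x y}. f x y)"
    by (simp add: nbrs_def)
  also have "\<dots> = (\<Sum>y\<in>V. \<Sum>x\<in>{x\<in>V. adj x y}. f x y)"
    using finite_V by (rule sum.swap_restrict[OF _ finite_V])
  also have "\<dots> = (\<Sum>y\<in>V. \<Sum>x\<in>nbrs y. f x y)"
    using adj_sym by (intro sum.cong) (auto simp: nbrs_def)
  finally show ?thesis .
qed

text \<open>Chapman-Kolmogorov: both factors contain the reciprocal degree of the meeting vertex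
  \<open>z\<close>, and \<open>dg z\<close> removes the duplicate.\<close>

lemma K_add:
  assumes "x \<in> V"
  shows "K (a + b) x y = (\<Sum>z\<in>V. dg z * K a x z * K b z y)"
  using assms
proof (induction a arbitrary: x)
  case 0
  have "(\<Sum>z\<in>V. dg z * K 0 x z * K b z y) = (\<Sum>z\<in>V. if x = z then K b z y else 0)"
    using dg_pos by (intro sum.cong) force+
  then show ?case using 0 finite_V by simp
next
  case (Suc a)
  have "K (Suc a + b) x y = (\<Sum>u\<in>nbrs x. \<Sum>z\<in>V. dg z * K a u z * K b z y) / dg x"
    using Suc.IH nbrs_sub by (auto intro!: sum.cong arg_cong[where f="\<lambda>t. t / dg x"])
  also have "\<dots> = (\<Sum>z\<in>V. \<Sum>u\<in>nbrs x. dg z * K a u z * K b z y) / dg x"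
    by (subst sum.swap) simp
  also have "\<dots> = (\<Sum>z\<in>V. dg z * K (Suc a) x z * K b z y)"
    by (simp add: sum_divide_distrib sum_distrib_left sum_distrib_right)
  finally show ?case .
qed

lemma K_one:
  assumes "x \<in> V" "y \<in> V"
  shows "K (Suc 0) x y = K (Suc 0) y x"
proof -
  have *: "K (Suc 0) x y = (if y \<in> nbrs x then 1 / (dg x * dg y) else 0)" for x y
    by simp
  show ?thesis using in_nbrs_sym assms unfolding * by (auto simp: mult.commute)
qed

text \<open>Reversing a walk keeps its weight. The recursion of \<open>K\<close> splits off the
  first step, so the induction uses \<open>K_add\<close> to split off the last step on the other
  side.\<close>

lemma K_sym:
  assumes "x \<in> V" "y \<in> V"
  shows "K k x y = K k y x"
  using assms
proof (induction k arbitrary: x y)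
  case (Suc k)
  have "K (k + Suc 0) x y = (\<Sum>z\<in>V. dg z * K k x z * K (Suc 0) z y)"
    by (rule K_add) fact
  also have "\<dots> = (\<Sum>z\<in>V. dg z * K (Suc 0) y z * K k z x)"
    using Suc K_one by (intro sum.cong) (auto simp del: K.simps)
  also have "\<dots> = K (Suc 0 + k) y x"
    by (rule K_add[symmetric]) fact
  finally show ?case by (simp del: K.simps)
qed auto

text \<open>\<open>dg y * K k x y\<close> is the probability that the random walk from
  \<open>x\<close> is at \<open>y\<close> after \<open>k\<close> steps.\<close>

lemma K_row_sum:
  assumes "x \<in> V"
  shows "(\<Sum>y\<in>V. dg y * K k x y) = 1"
  using assms
proof (induction k arbitrary: x)
  case 0
  have "(\<Sum>y\<in>V. dg y * K 0 x y) = (\<Sum>y\<in>V. if x = y then 1 else 0)"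
    using dg_pos by (intro sum.cong) force+
  then show ?case using 0 finite_V by simp
next
  case (Suc k)
  have "(\<Sum>y\<in>V. dg y * K (Suc k) x y) = (\<Sum>y\<in>V. \<Sum>u\<in>nbrs x. dg y * K k u y) / dg x"
    by (simp add: sum_divide_distrib sum_distrib_left)
  also have "\<dots> = (\<Sum>u\<in>nbrs x. \<Sum>y\<in>V. dg y * K k u y) / dg x"
    by (subst sum.swap) simp
  also have "(\<Sum>u\<in>nbrs x. \<Sum>y\<in>V. dg y * K k u y) = (\<Sum>u\<in>nbrs x. 1)"
    using Suc.IH nbrs_sub by (intro sum.cong) auto
  also have "(\<Sum>u\<in>nbrs x. 1) / dg x = 1"
    using dg_pos[OF Suc.prems] by (auto simp: dg_def card_gt_0_iff)
  finally show ?case .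
qed

section \<open>The traces \<open>T\<close> as inner products, and their growth\<close>

lemma T_add: "T (a + b) = (\<Sum>x\<in>V. \<Sum>y\<in>V. dg x * dg y * K a x y * K b x y)"
  unfolding T_def
proof (intro sum.cong refl)
  fix x assume x: "x \<in> V"
  have "K (a + b) x x = (\<Sum>z\<in>V. dg z * K a x z * K b z x)"
    using K_add[OF x] .
  also have "\<dots> = (\<Sum>z\<in>V. dg z * K a x z * K b x z)"
    using K_sym x by (intro sum.cong) auto
  finally show "dg x * K (a + b) x x = (\<Sum>y\<in>V. dg x * dg y * K a x y * K b x y)"
    by (simp add: sum_distrib_left mult.assoc)
qed

lemma T_double: "T (2 * a) = (\<Sum>x\<in>V. \<Sum>y\<in>V. dg x * dg y * (K a x y)\<^sup>2)"
  using T_add[of a a] by (simp add: mult_2 power2_eq_square mult.assoc)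

text \<open>Cauchy-Schwarz for the inner product in \<open>T_add\<close>, whose weight
  \<open>dg x * dg y\<close> is split between the factors by square roots.\<close>

lemma T_log_convex: "(T (a + b))\<^sup>2 \<le> T (2 * a) * T (2 * b)"
proof -
  have sqrt_sq: "sqrt (dg x * dg y) * s * (sqrt (dg x * dg y) * t) = dg x * dg y * s * t" for x y s t
  proof -
    have "sqrt (dg x * dg y) * s * (sqrt (dg x * dg y) * t) = (sqrt (dg x * dg y) * sqrt (dg x * dg y)) * s * t"
      by (simp only: ac_simps)
    then show ?thesis by simp
  qed
  let ?f = "\<lambda>k (x, y). sqrt (dg x * dg y) * K k x y"
  have sq: "(?f k p)\<^sup>2 = (case p of (x, y) \<Rightarrow> dg x * dg y * (K k x y)\<^sup>2)" for k p
    by (cases p) (simp add: power_mult_distrib)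
  have pr: "?f a p * ?f b p = (case p of (x, y) \<Rightarrow> dg x * dg y * K a x y * K b x y)" for p
    using sqrt_sq by (cases p) auto
  have "(\<Sum>p\<in>V\<times>V. ?f a p * ?f b p)\<^sup>2 \<le> (\<Sum>p\<in>V\<times>V. (?f a p)\<^sup>2) * (\<Sum>p\<in>V\<times>V. (?f b p)\<^sup>2)"
    by (rule Cauchy_Schwarz_ineq_sum)
  then show ?thesis
    unfolding sq pr T_double T_add[of a b] sum.cartesian_product .
qed

text \<open>Spectrally, the eigenvalue 1 of the random walk contributes 1 to the trace, and no
  eigenvalue contributes negatively to an even power. Here Cauchy-Schwarz pairs \<open>K a\<close>
  with the constant function 1: the inner product is \<open>D\<close> and the constant has squared
  norm \<open>D * D\<close>.\<close>

lemma T_double_ge_1: "1 \<le> T (2 * a)"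
proof -
  define D where "D = (\<Sum>x\<in>V. dg x)"
  have D: "0 < D" unfolding D_def
    using finite_V V_nonempty dg_pos by (intro sum_pos) auto
  have sqrt_sq: "sqrt (dg x * dg y) * (sqrt (dg x * dg y) * t) = dg x * dg y * t" for x y t
  proof -
    have "sqrt (dg x * dg y) * (sqrt (dg x * dg y) * t) = (sqrt (dg x * dg y) * sqrt (dg x * dg y)) * t"
      by (simp only: ac_simps)
    then show ?thesis by simp
  qed
  let ?w = "\<lambda>(x, y). sqrt (dg x * dg y)"
  let ?f = "\<lambda>(x, y). sqrt (dg x * dg y) * K a x y"
  have pr: "?w p * ?f p = (case p of (x, y) \<Rightarrow> dg x * (dg y * K a x y))" for p
    using sqrt_sq by (cases p) auto
  have sq: "(?f p)\<^sup>2 = (case p of (x, y) \<Rightarrow> dg x * dg y * (K a x y)\<^sup>2)" for p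
    by (cases p) (simp add: power_mult_distrib)
  have sw: "(?w p)\<^sup>2 = (case p of (x, y) \<Rightarrow> dg x * dg y)" for p
    by (cases p) simp
  have "(\<Sum>p\<in>V\<times>V. ?w p * ?f p) = (\<Sum>x\<in>V. dg x * (\<Sum>y\<in>V. dg y * K a x y))"
    unfolding pr by (simp add: sum.cartesian_product sum_distrib_left)
  also have "\<dots> = D" using K_row_sum by (simp add: D_def)
  finally have 1: "(\<Sum>p\<in>V\<times>V. ?w p * ?f p) = D" .
  have 2: "(\<Sum>p\<in>V\<times>V. (?w p)\<^sup>2) = D * D"
    unfolding sw D_def sum_product sum.cartesian_product ..
  have 3: "(\<Sum>p\<in>V\<times>V. (?f p)\<^sup>2) = T (2 * a)"
    unfolding sq T_double sum.cartesian_product ..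
  have "D\<^sup>2 \<le> D * D * T (2 * a)"
    using Cauchy_Schwarz_ineq_sum[of ?w ?f "V \<times> V"] unfolding 1 2 3 .
  then show ?thesis using D by (simp add: power2_eq_square)
qed

text \<open>By log-convexity the ratios of consecutive even traces do not decrease, so
  \<open>T (2 * j) / T 0\<close>, a product of \<open>j\<close> ratios, is at most the
  \<open>j\<close>-th power of the next ratio. The statement is this with
  \<open>T 0 = card V\<close> and the denominators cleared.\<close>

lemma T_power_le: "T (2 * j) ^ Suc j \<le> real (card V) * T (2 * Suc j) ^ j"
proof (induction j)
  case 0
  have "T 0 = (\<Sum>x\<in>V. 1)" unfolding T_def
    using dg_pos by (intro sum.cong) force+
  then show ?case by simp
next
  case (Suc j)
  let ?A = "T (2 * j)" and ?B = "T (2 * Suc j)" and ?C = "T (2 * Suc (Suc j))"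
  have B: "0 < ?B" using T_double_ge_1[of "Suc j"] by linarith
  have C: "0 < ?C" using T_double_ge_1[of "Suc (Suc j)"] by linarith
  \<comment> \<open>With this splitting, log-convexity bounds the middle one of three consecutive
    even traces.\<close>
  have "2 * Suc j = j + Suc (Suc j)" by simp
  then have "?B\<^sup>2 \<le> ?A * ?C"
    using T_log_convex[of j "Suc (Suc j)"] by (simp only:)
  then have "(?B\<^sup>2) ^ Suc j \<le> (?A * ?C) ^ Suc j"
    by (rule power_mono) (rule zero_le_power2)
  also have "\<dots> = ?A ^ Suc j * ?C ^ Suc j" by (rule power_mult_distrib)
  also have "\<dots> \<le> (real (card V) * ?B ^ j) * ?C ^ Suc j"
    using Suc.IH by (rule mult_right_mono) (use C in \<open>rule zero_le_power[OF less_imp_le]\<close>)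
  finally have "(?B\<^sup>2) ^ Suc j \<le> (real (card V) * ?B ^ j) * ?C ^ Suc j" .
  moreover have "(?B\<^sup>2) ^ Suc j = ?B ^ j * ?B ^ Suc (Suc j)"
    unfolding power_mult[symmetric] power_add[symmetric] by (rule arg_cong[of _ _ "power ?B"]) simp
  ultimately have "?B ^ j * ?B ^ Suc (Suc j) \<le> ?B ^ j * (real (card V) * ?C ^ Suc j)"
    by (simp only: mult.commute mult.left_commute)
  then show ?case using B by (simp only: mult_le_cancel_left_pos zero_less_power)
qed

lemma T_pred_le:
  assumes "1 \<le> k" "real (card V) \<le> r ^ k" "0 \<le> r"
  shows "T (2 * (k - 1)) \<le> r * T (2 * k)"
proof -
  obtain j where k: "k = Suc j" using assms(1) by (cases k) auto
  have 1: "1 \<le> T (2 * k)" by (rule T_double_ge_1)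
  have "T (2 * j) ^ Suc j \<le> real (card V) * T (2 * Suc j) ^ j" by (rule T_power_le)
  \<comment> \<open>\<open>T (2 * k)\<close> is at least 1, so its exponent may be raised to
    \<open>Suc j\<close>; both sides are then powers of which a root can be taken.\<close>
  also have "\<dots> \<le> r ^ Suc j * T (2 * Suc j) ^ Suc j"
    using assms 1 k by (intro mult_mono power_increasing) auto
  also have "\<dots> = (r * T (2 * Suc j)) ^ Suc j" by (simp only: power_mult_distrib)
  finally have "T (2 * j) \<le> r * T (2 * Suc j)"
    by (rule power_le_imp_le_base) (use assms(3) 1 k in auto)
  then show ?thesis using k by simp
qed

section \<open>Walks as lists, and their weights\<close>

definition wt :: "'v list \<Rightarrow> real" where
  "wt xs = (\<Prod>v\<leftarrow>xs. 1 / dg v)"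

definition walks :: "nat \<Rightarrow> 'v list set" where
  "walks k = {xs. length xs = Suc k \<and> set xs \<subseteq> V \<and> successively adj xs}"

text \<open>The start is not repeated at the end, so there are \<open>m\<close> vertices for
  \<open>m\<close> cyclic edges and \<open>wt\<close> counts each position once.\<close>

definition closed_walks :: "nat \<Rightarrow> 'v list set" where
  "closed_walks m = {xs. length xs = m \<and> set xs \<subseteq> V \<and>
     (\<forall>i<m. adj (xs ! i) (xs ! (Suc i mod m)))}"

lemma wt_simps [simp]: "wt [] = 1" "wt (x # xs) = wt xs / dg x" "wt (xs @ ys) = wt xs * wt ys"
  by (simp_all add: wt_def)

lemma wt_nonneg [simp]: "0 \<le> wt xs"
  by (induction xs) auto

lemma wt_pos: "set xs \<subseteq> V \<Longrightarrow> 0 < wt xs"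
  by (induction xs) (auto simp: dg_pos)

lemma wt_rotate: "wt (rotate i xs) = wt xs"
proof (induction i)
  case (Suc i)
  have "wt (rotate1 ys) = wt ys" for ys by (cases ys) auto
  with Suc show ?case by simp
qed simp

lemma finite_walks [simp]: "finite (walks k)"
  by (rule finite_subset[OF _ finite_lists_length_eq[OF finite_V, of "Suc k"]])
    (auto simp: walks_def)

lemma finite_closed_walks [simp]: "finite (closed_walks k)"
  by (rule finite_subset[OF _ finite_lists_length_eq[OF finite_V, of k]])
    (auto simp: closed_walks_def)

lemma walks_ends: "P \<in> walks k \<Longrightarrow> hd P \<in> V \<and> last P \<in> V"
  by (cases P) (auto simp: walks_def)

lemma walks_Suc_from:
  assumes "x \<in> V"
  shows "{P \<in> walks (Suc k). hd P = x \<and> last P = y} =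
    (\<Union>u\<in>nbrs x. (#) x ` {P \<in> walks k. hd P = u \<and> last P = y})" (is "?L = ?R")
proof
  show "?L \<subseteq> ?R"
  proof
    fix P assume "P \<in> ?L"
    then obtain Q where P: "P = x # Q" and Q: "length Q = Suc k" "set Q \<subseteq> V"
        "successively adj (x # Q)" "last (x # Q) = y"
      by (cases P) (auto simp: walks_def)
    then obtain u Q' where "Q = u # Q'" by (cases Q) auto
    with P Q show "P \<in> ?R" by (auto simp: walks_def nbrs_def)
  qed
  show "?R \<subseteq> ?L"
    using assms by (auto simp: walks_def nbrs_def successively_Cons)
qed

lemma sum_walks_K:
  assumes "x \<in> V" "y \<in> V"
  shows "(\<Sum>P | P \<in> walks k \<and> hd P = x \<and> last P = y. wt P) = K k x y"
  using assms
proof (induction k arbitrary: x)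
  case 0
  have "{P. P \<in> walks 0 \<and> hd P = x \<and> last P = y} = (if x = y then {[x]} else {})"
    using 0 by (auto simp: walks_def length_Suc_conv)
  then show ?case by simp
next
  case (Suc k)
  have "(\<Sum>P | P \<in> walks (Suc k) \<and> hd P = x \<and> last P = y. wt P)
      = (\<Sum>u\<in>nbrs x. \<Sum>P\<in>(#) x ` {P \<in> walks k. hd P = u \<and> last P = y}. wt P)"
    unfolding walks_Suc_from[OF Suc.prems(1)] by (rule sum.UNION_disjoint) auto
  also have "\<dots> = (\<Sum>u\<in>nbrs x. (\<Sum>P | P \<in> walks k \<and> hd P = u \<and> last P = y. wt P) / dg x)"
    by (subst sum.reindex) (auto simp: sum_divide_distrib)
  also have "\<dots> = (\<Sum>u\<in>nbrs x. K k u y / dg x)"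
    using Suc nbrs_sub[of x] by (intro sum.cong) auto
  also have "\<dots> = K (Suc k) x y"
    by (simp add: sum_divide_distrib)
  finally show ?case .
qed

lemma sum_walks_ends:
  "(\<Sum>P\<in>walks k. wt P * g (hd P) (last P)) = (\<Sum>x\<in>V. \<Sum>y\<in>V. K k x y * g x y)"
proof -
  have "(\<Sum>P\<in>walks k. wt P * g (hd P) (last P)) =
    (\<Sum>p\<in>V\<times>V. \<Sum>P | P \<in> walks k \<and> (hd P, last P) = p. wt P * g (hd P) (last P))"
    by (rule sum.group[symmetric]) (use walks_ends finite_V in auto)
  also have "\<dots> = (\<Sum>x\<in>V. \<Sum>y\<in>V. \<Sum>P | P \<in> walks k \<and> hd P = x \<and> last P = y. wt P * g x y)"
    by (auto simp: sum.cartesian_product intro!: sum.cong)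
  also have "\<dots> = (\<Sum>x\<in>V. \<Sum>y\<in>V. K k x y * g x y)"
    by (simp add: sum_walks_K flip: sum_distrib_right)
  finally show ?thesis .
qed

text \<open>\<open>P\<close> is one of the walks summed by \<open>K\<close>. With
  \<open>wt_pos\<close> this makes \<open>K\<close> positive at the ends of an actual walk, so that
  it can serve as a denominator.\<close>

lemma wt_le_K: "P \<in> walks k \<Longrightarrow> wt P \<le> K k (hd P) (last P)"
  using walks_ends[of P k]
  by (subst sum_walks_K[symmetric]) (auto intro!: member_le_sum)

text \<open>The factor \<open>dg x\<close> in \<open>T\<close> cancels the second occurrence of
  \<open>x\<close> in a walk from \<open>x\<close> back to \<open>x\<close>; deleting that
  occurrence leaves a closed walk.\<close>

lemma T_le_closed_walks:
  assumes "1 \<le> m"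
  shows "T m \<le> (\<Sum>xs\<in>closed_walks m. wt xs)"
proof -
  let ?Z = "\<lambda>x. {P. P \<in> walks m \<and> hd P = x \<and> last P = x}"
  have "T m = (\<Sum>x\<in>V. \<Sum>P\<in>?Z x. dg x * wt P)"
    unfolding T_def by (simp add: sum_walks_K flip: sum_distrib_left)
  also have "\<dots> = (\<Sum>x\<in>V. \<Sum>P\<in>?Z x. wt (butlast P))"
  proof (intro sum.cong refl)
    fix x P assume x: "x \<in> V" and P: "P \<in> ?Z x"
    then have "P \<noteq> []" by (auto simp: walks_def)
    then have "P = butlast P @ [x]" using P by (metis (mono_tags) append_butlast_last_id mem_Collect_eq)
    then have "wt P = wt (butlast P) / dg x" by (metis wt_simps(1,2,3) times_divide_eq_right mult.right_neutral)
    then show "dg x * wt P = wt (butlast P)" using dg_pos[OF x] by simp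
  qed
  also have "\<dots> = (\<Sum>P\<in>(\<Union>x\<in>V. ?Z x). wt (butlast P))"
    by (rule sum.UNION_disjoint[symmetric]) (use finite_V in auto)
  also have "\<dots> = (\<Sum>xs\<in>butlast ` (\<Union>x\<in>V. ?Z x). wt xs)"
  proof (subst sum.reindex)
    \<comment> \<open>As \<open>m\<close> is at least 1, the head survives in
      \<open>butlast P\<close>, and it equals the deleted vertex.\<close>
    show "inj_on butlast (\<Union>x\<in>V. ?Z x)"
    proof (rule inj_onI, clarsimp)
      fix P Q assume a: "P \<in> walks m" "Q \<in> walks m" "last P = hd P" "last Q = hd Q" "butlast P = butlast Q"
      then have ne: "butlast P \<noteq> []" "butlast Q \<noteq> []" using assms
        by (auto simp: walks_def simp flip: length_0_conv)
      then have "hd P = hd (butlast P)" "hd Q = hd (butlast Q)"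
        by (metis append_butlast_last_id butlast.simps(1) hd_append2)+
      then show "P = Q" using a ne by (metis append_butlast_last_id butlast.simps(1))
    qed
  qed auto
  also have "\<dots> \<le> (\<Sum>xs\<in>closed_walks m. wt xs)"
  proof (rule sum_mono2)
    show "butlast ` (\<Union>x\<in>V. ?Z x) \<subseteq> closed_walks m"
    proof
      fix xs assume "xs \<in> butlast ` (\<Union>x\<in>V. ?Z x)"
      then obtain P where P: "P \<in> walks m" "last P = hd P" and xs: "xs = butlast P" by auto
      then have ne: "P \<noteq> []" and len: "length P = Suc m" by (auto simp: walks_def)
      have "adj (butlast P ! i) (butlast P ! (Suc i mod m))" if i: "i < m" for i
      proof -
        have 1: "adj (P ! i) (P ! Suc i)"
          using P i len by (auto simp: walks_def successively_conv_nth)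
        have "P ! Suc i = butlast P ! (Suc i mod m)"
        proof (cases "Suc i < m")
          case True then show ?thesis by (simp add: nth_butlast len)
        next
          case False
          then have "Suc i = m" using i by simp
          then show ?thesis using ne len P assms by (simp add: nth_butlast last_conv_nth hd_conv_nth)
        qed
        then show ?thesis using 1 i len by (simp add: nth_butlast)
      qed
      moreover have "set (butlast P) \<subseteq> V" using P by (auto simp: walks_def dest: in_set_butlastD)
      ultimately show "xs \<in> closed_walks m" by (auto simp: xs closed_walks_def len)
    qed
  qed auto
  finally show ?thesis .
qed

lemma rotate_closed_walk:
  assumes "xs \<in> closed_walks m"
  shows "rotate i xs \<in> closed_walks m"
proof -
  have "adj (rotate i xs ! j) (rotate i xs ! (Suc j mod m))" if "j < m" for j
  proof -
    have "adj (xs ! ((i + j) mod m)) (xs ! (Suc ((i + j) mod m) mod m))"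
      using assms that by (auto simp: closed_walks_def)
    also have "Suc ((i + j) mod m) mod m = (i + Suc j mod m) mod m"
      by (simp add: mod_simps)
    finally show ?thesis using that assms
      by (auto simp: closed_walks_def nth_rotate)
  qed
  then show ?thesis using assms by (auto simp: closed_walks_def)
qed

section \<open>Conflicts in closed walks\<close>

lemma closed_walk_successively:
  assumes "xs \<in> closed_walks m" "xs \<noteq> []"
  shows "successively adj (xs @ [hd xs])"
  unfolding successively_conv_nth
proof (intro allI impI)
  fix i assume i: "Suc i < length (xs @ [hd xs])"
  then have *: "adj (xs ! i) (xs ! (Suc i mod length xs))"
    using assms by (auto simp: closed_walks_def)
  show "adj ((xs @ [hd xs]) ! i) ((xs @ [hd xs]) ! Suc i)"
  proof (cases "Suc i < length xs")
    case True then show ?thesis using * by (simp add: nth_append)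
  next
    case False
    then have "Suc i = length xs" using i by simp
    then show ?thesis using * assms(2) by (simp add: nth_append hd_conv_nth)
  qed
qed

text \<open>The walk is cut as \<open>x # P @ Q'\<close>, with \<open>k\<close> vertices in
  \<open>P\<close> and a return of \<open>k\<close> edges from \<open>last P\<close> to
  \<open>x\<close>. Once \<open>P\<close> is fixed, the conflict leaves at most \<open>s\<close>
  choices of \<open>x\<close>. AM-GM with parameter \<rho> separates a term summed over all
  neighbours \<open>x\<close> from a term in which the choices of \<open>x\<close> are only
  counted.\<close>

lemma sum_wt_conflict_path:
  assumes k: "1 \<le> k" and \<rho>: "0 < \<rho>"
    and X: "X \<subseteq> closed_walks (2 * k)"
    and s: "\<And>P. P \<in> walks (k - 1) \<Longrightarrow> real (card {x \<in> nbrs (hd P). B x P}) \<le> s"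
    and B: "\<And>xs. xs \<in> X \<Longrightarrow> B (hd xs) (take k (tl xs))"
    and s0: "0 \<le> s"
  shows "sum wt X \<le> (\<rho> * T (2 * k) + s / (\<rho> * \<delta>) * T (2 * (k - 1))) / 2"
proof -
  obtain j where j: "k = Suc j" using k by (cases k) auto
  define Z where "Z = (SIGMA P:walks j. SIGMA x:{x \<in> nbrs (hd P). B x P}.
    {Q. Q \<in> walks k \<and> hd Q = last P \<and> last Q = x})"
  define f where "f xs = (take k (tl xs), hd xs, last (take k (tl xs)) # drop k (tl xs) @ [hd xs])" for xs :: "'v list"
  \<comment> \<open>The return walk \<open>Q\<close> contains both of its ends, so
    \<open>last P\<close> occurs in \<open>P\<close> and in \<open>Q\<close>;
    \<open>dg (last P)\<close> corrects for this.\<close>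
  define h where "h = (\<lambda>(P, x :: 'v, Q). wt P * (dg (last P) * wt Q))"
  have f: "f xs \<in> Z \<and> h (f xs) = wt xs" if xs: "xs \<in> X" for xs
  proof -
    have c: "xs \<in> closed_walks (2 * k)" using X xs by blast
    then have len: "length xs = 2 * k" and V: "set xs \<subseteq> V" by (auto simp: closed_walks_def)
    then have ne: "xs \<noteq> []" using j by auto
    define x P Q' where "x = hd xs" and "P = take k (tl xs)" and "Q' = drop k (tl xs)"
    have xs_eq: "xs = x # P @ Q'" using ne by (simp add: x_def P_def Q'_def)
    have lP: "length P = Suc j" and lQ: "length Q' = j" using len j by (auto simp: P_def Q'_def)
    have "P \<noteq> []" using lP by auto
    have "successively adj (x # P @ Q' @ [x])"
      using closed_walk_successively[OF c ne] by (simp add: xs_eq)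
    then have "successively adj P" "adj x (hd P)" "successively adj (last P # Q' @ [x])"
      using \<open>P \<noteq> []\<close> by (auto simp: successively_append_iff successively_Cons split: if_splits)
    moreover have "last P \<in> V" using V \<open>P \<noteq> []\<close> by (auto simp: xs_eq)
    ultimately have "f xs \<in> Z"
      using V lP lQ B[OF xs]
      by (auto simp: f_def Z_def walks_def nbrs_def j adj_sym simp flip: x_def P_def Q'_def)
        (use \<open>P \<noteq> []\<close> in \<open>auto simp: xs_eq adj_sym\<close>)
    moreover have "h (f xs) = wt xs"
      using dg_pos[OF \<open>last P \<in> V\<close>]
      by (simp add: h_def f_def flip: x_def P_def Q'_def) (simp add: xs_eq)
    ultimately show ?thesis by blast
  qed
  have inj: "inj_on f X"
  proof (rule inj_onI)
    fix xs ys assume "xs \<in> X" "ys \<in> X" and eq: "f xs = f ys"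
    then have "xs \<noteq> []" "ys \<noteq> []" using X k by (auto simp: closed_walks_def)
    moreover have "hd xs = hd ys" "take k (tl xs) = take k (tl ys)" "drop k (tl xs) = drop k (tl ys)"
      using eq by (auto simp: f_def)
    ultimately show "xs = ys" by (metis append_take_drop_id hd_Cons_tl)
  qed
  have finZ: "finite Z" unfolding Z_def by (intro finite_SigmaI) auto
  have "sum wt X = sum h (f ` X)"
    using inj f by (simp add: sum.reindex)
  also have "\<dots> \<le> sum h Z"
  proof (rule sum_mono2[OF finZ])
    show "f ` X \<subseteq> Z" using f by blast
    show "0 \<le> h b" for b by (auto simp: h_def split: prod.splits)
  qed
  also have "\<dots> = (\<Sum>P\<in>walks j. \<Sum>x\<in>{x \<in> nbrs (hd P). B x P}. wt P * (dg (last P) * K k x (last P)))"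
  proof -
    have "sum h Z = (\<Sum>P\<in>walks j. \<Sum>x\<in>{x \<in> nbrs (hd P). B x P}.
        \<Sum>Q | Q \<in> walks k \<and> hd Q = last P \<and> last Q = x. wt P * (dg (last P) * wt Q))"
      unfolding Z_def h_def by (simp add: sum.Sigma split_def)
    also have "\<dots> = (\<Sum>P\<in>walks j. \<Sum>x\<in>{x \<in> nbrs (hd P). B x P}. wt P * (dg (last P) * K k (last P) x))"
      using walks_ends nbrs_sub
      by (intro sum.cong refl) (subst sum_walks_K[symmetric]; auto simp: sum_distrib_left)
    also have "\<dots> = (\<Sum>P\<in>walks j. \<Sum>x\<in>{x \<in> nbrs (hd P). B x P}. wt P * (dg (last P) * K k x (last P)))"
      using walks_ends nbrs_sub by (intro sum.cong refl) (subst K_sym; auto)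
    finally show ?thesis .
  qed
  also have "\<dots> \<le> (\<Sum>P\<in>walks j. \<Sum>x\<in>{x \<in> nbrs (hd P). B x P}.
      wt P * (\<rho> * dg (last P) * (K k x (last P))\<^sup>2 / K j (hd P) (last P) / 2)
      + wt P * (dg (last P) * K j (hd P) (last P) / (2 * \<rho>)))"
  proof (intro sum_mono)
    fix P x assume P: "P \<in> walks j"
    let ?a = "K k x (last P)" and ?b = "K j (hd P) (last P)"
    have b: "0 < ?b" using wt_le_K[OF P] wt_pos[of P] P by (auto simp: walks_def)
    \<comment> \<open>AM-GM as a nonnegative square. The comparison value \<open>?b\<close> is the
      total weight of the walks with the ends of \<open>P\<close>, so summing \<open>wt P\<close>
      over these cancels it in the first term and squares it in the second.\<close>
    have "0 \<le> (\<rho> * ?a - ?b)\<^sup>2 / (2 * \<rho> * ?b)" using \<rho> b by simp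
    also have "\<dots> = \<rho> * ?a\<^sup>2 / ?b / 2 + ?b / (2 * \<rho>) - ?a"
      using \<rho> b by (simp add: field_simps power2_eq_square)
    finally have "wt P * dg (last P) * ?a \<le> wt P * dg (last P) * (\<rho> * ?a\<^sup>2 / ?b / 2 + ?b / (2 * \<rho>))"
      by (intro mult_left_mono) auto
    then show "wt P * (dg (last P) * ?a) \<le>
      wt P * (\<rho> * dg (last P) * ?a\<^sup>2 / ?b / 2) + wt P * (dg (last P) * ?b / (2 * \<rho>))"
      by (simp add: algebra_simps)
  qed
  also have "\<dots> = (\<Sum>P\<in>walks j. \<Sum>x\<in>{x \<in> nbrs (hd P). B x P}.
      wt P * (\<rho> * dg (last P) * (K k x (last P))\<^sup>2 / K j (hd P) (last P) / 2))
      + (\<Sum>P\<in>walks j. real (card {x \<in> nbrs (hd P). B x P}) *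
           (wt P * (dg (last P) * K j (hd P) (last P) / (2 * \<rho>))))"
    by (simp add: sum.distrib)
  \<comment> \<open>Here the restriction to conflicting \<open>x\<close> is dropped; summing over
    the neighbours \<open>u\<close> of \<open>x\<close> then supplies the factor \<open>dg x\<close>
    of \<open>T (2 * k)\<close>.\<close>
  also have "(\<Sum>P\<in>walks j. \<Sum>x\<in>{x \<in> nbrs (hd P). B x P}.
      wt P * (\<rho> * dg (last P) * (K k x (last P))\<^sup>2 / K j (hd P) (last P) / 2)) \<le> \<rho> * T (2 * k) / 2"
  proof -
    define g where "g u y = (\<Sum>x\<in>nbrs u. \<rho> * dg y * (K k x y)\<^sup>2 / K j u y / 2)" for u y
    have "(\<Sum>P\<in>walks j. \<Sum>x\<in>{x \<in> nbrs (hd P). B x P}.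
      wt P * (\<rho> * dg (last P) * (K k x (last P))\<^sup>2 / K j (hd P) (last P) / 2))
      \<le> (\<Sum>P\<in>walks j. \<Sum>x\<in>nbrs (hd P).
      wt P * (\<rho> * dg (last P) * (K k x (last P))\<^sup>2 / K j (hd P) (last P) / 2))"
      using \<rho> by (intro sum_mono sum_mono2) auto
    also have "\<dots> = (\<Sum>u\<in>V. \<Sum>y\<in>V. K j u y * g u y)"
      unfolding sum_walks_ends[symmetric] g_def by (simp add: sum_distrib_left)
    \<comment> \<open>An inequality, since the left side vanishes by division by zero where
      \<open>K j u y = 0\<close>.\<close>
    also have "\<dots> \<le> (\<Sum>u\<in>V. \<Sum>y\<in>V. \<Sum>x\<in>nbrs u. \<rho> / 2 * (dg y * (K k x y)\<^sup>2))"
      unfolding g_def sum_distrib_left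
      using \<rho> by (intro sum_mono) (simp add: divide_simps)
    also have "\<dots> = (\<Sum>u\<in>V. \<Sum>x\<in>nbrs u. \<Sum>y\<in>V. \<rho> / 2 * (dg y * (K k x y)\<^sup>2))"
      by (intro sum.cong refl sum.swap)
    also have "\<dots> = (\<Sum>x\<in>V. \<Sum>u\<in>nbrs x. \<Sum>y\<in>V. \<rho> / 2 * (dg y * (K k x y)\<^sup>2))"
      by (rule sum_nbrs_swap)
    also have "\<dots> = \<rho> * T (2 * k) / 2"
      unfolding T_double by (simp add: sum_distrib_left dg_def mult_ac)
    finally show ?thesis .
  qed
  also have "(\<Sum>P\<in>walks j. real (card {x \<in> nbrs (hd P). B x P}) *
           (wt P * (dg (last P) * K j (hd P) (last P) / (2 * \<rho>))))
      \<le> (\<Sum>P\<in>walks j. wt P * (s * dg (last P) * K j (hd P) (last P) / (2 * \<rho>)))"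
  proof (rule sum_mono)
    fix P assume "P \<in> walks j"
    then have "real (card {x \<in> nbrs (hd P). B x P}) \<le> s" using s j by simp
    then have "real (card {x \<in> nbrs (hd P). B x P}) * (wt P * (dg (last P) * K j (hd P) (last P) / (2 * \<rho>)))
      \<le> s * (wt P * (dg (last P) * K j (hd P) (last P) / (2 * \<rho>)))"
      using \<rho> by (intro mult_right_mono) auto
    then show "real (card {x \<in> nbrs (hd P). B x P}) * (wt P * (dg (last P) * K j (hd P) (last P) / (2 * \<rho>)))
      \<le> wt P * (s * dg (last P) * K j (hd P) (last P) / (2 * \<rho>))" by (simp add: mult_ac)
  qed
  also have "\<dots> = (\<Sum>x\<in>V. \<Sum>y\<in>V. K j x y * (s * dg y * K j x y / (2 * \<rho>)))"
    by (rule sum_walks_ends)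
  \<comment> \<open>The factor \<open>dg x\<close> of the trace is missing; inserting it gains
    \<open>1 / \<delta>\<close>.\<close>
  also have "\<dots> \<le> (\<Sum>x\<in>V. \<Sum>y\<in>V. s / (2 * \<rho> * \<delta>) * (dg x * dg y * (K j x y)\<^sup>2))"
  proof (intro sum_mono)
    fix x y assume "x \<in> V"
    then have "1 \<le> dg x / \<delta>" using dg_ge min_degree_pos by simp
    then have "s * dg y * (K j x y)\<^sup>2 / (2 * \<rho>) * 1 \<le> s * dg y * (K j x y)\<^sup>2 / (2 * \<rho>) * (dg x / \<delta>)"
      using \<rho> s0 by (intro mult_left_mono) auto
    then show "K j x y * (s * dg y * K j x y / (2 * \<rho>)) \<le> s / (2 * \<rho> * \<delta>) * (dg x * dg y * (K j x y)\<^sup>2)"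
      by (simp add: power2_eq_square mult_ac)
  qed
  also have "\<dots> = s / (2 * \<rho> * \<delta>) * T (2 * (k - 1))"
    unfolding T_double by (simp add: sum_distrib_left j)
  finally show ?thesis by (simp add: add_divide_distrib)
qed

text \<open>This treats two opposite edges, where the path \<open>P\<close> of the previous lemma
  contains only one end of the second edge. Cutting at both edges leaves two halves of
  \<open>k\<close> vertices each, coupled only through their ends, and AM-GM is applied to the
  kernels of the two halves.\<close>

lemma sum_wt_conflict_antipodal:
  assumes k: "1 \<le> k"
    and X: "X \<subseteq> closed_walks (2 * k)"
    and s: "\<And>y c. y \<in> V \<Longrightarrow> real (card {z \<in> nbrs y. \<phi> y z = c}) \<le> s"
    and B: "\<And>xs. xs \<in> X \<Longrightarrow> \<phi> (xs ! (k - 1)) (xs ! k) = \<phi> (xs ! (2 * k - 1)) (xs ! 0)"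
    and s0: "0 \<le> s"
  shows "sum wt X \<le> s / \<delta> * T (2 * (k - 1))"
proof -
  obtain j where j: "k = Suc j" using k by (cases k) auto
  \<comment> \<open>The halves run from \<open>x\<close> to \<open>y\<close> and from
    \<open>z\<close> to \<open>t\<close>. With the order \<open>\<phi> t x\<close>, exchanging the
    halves swaps the two sides of the colour equation, so \<open>I\<close> is symmetric.\<close>
  define I :: "'v \<times> 'v \<Rightarrow> 'v \<times> 'v \<Rightarrow> real" where
    "I = (\<lambda>(x, y) (z, t). if z \<in> nbrs y \<and> t \<in> nbrs x \<and> \<phi> y z = \<phi> t x then 1 else 0)"
  define L where "L = (\<lambda>(x, y). K j x y)"
  define e where "e P = (hd P, last P)" for P :: "'v list"
  define f where "f xs = (take k xs, drop k xs)" for xs :: "'v list"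
  define h where "h = (\<lambda>(P, Q). wt P * wt Q * I (e P) (e Q))"
  have f: "f xs \<in> walks j \<times> walks j \<and> h (f xs) = wt xs" if xs: "xs \<in> X" for xs
  proof -
    have c: "xs \<in> closed_walks (2 * k)" using X xs by blast
    then have len: "length xs = 2 * k" and V: "set xs \<subseteq> V" by (auto simp: closed_walks_def)
    then have ne: "xs \<noteq> []" using j by auto
    define P Q where "P = take k xs" and "Q = drop k xs"
    have xs_eq: "xs = P @ Q" by (simp add: P_def Q_def)
    have lP: "length P = k" and lQ: "length Q = k" using len j by (auto simp: P_def Q_def)
    then have ne': "P \<noteq> []" "Q \<noteq> []" using k by auto
    have "successively adj (P @ Q @ [hd P])"
      using closed_walk_successively[OF c ne] ne' by (simp add: xs_eq)
    then have "successively adj P" "successively adj Q" "adj (last P) (hd Q)" "adj (last Q) (hd P)"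
      using ne' by (auto simp: successively_append_iff)
    moreover have "\<phi> (last P) (hd Q) = \<phi> (last Q) (hd P)"
    proof -
      have "last P = xs ! (k - 1)" "hd Q = xs ! k" "last Q = xs ! (2 * k - 1)" "hd P = xs ! 0"
        using ne' lP lQ k by (auto simp: xs_eq last_conv_nth hd_conv_nth nth_append)
      then show ?thesis using B[OF xs] by simp
    qed
    moreover have "hd Q \<in> V" "last Q \<in> V" using V ne' by (auto simp: xs_eq)
    ultimately have "P \<in> walks j" "Q \<in> walks j" "I (e P) (e Q) = 1"
      using V lP lQ by (auto simp: walks_def j xs_eq I_def e_def nbrs_def adj_sym)
    then show ?thesis by (simp add: f_def h_def flip: P_def Q_def) (simp add: xs_eq)
  qed
  have inj: "inj_on f X"
    by (rule inj_onI) (metis append_take_drop_id f_def prod.inject)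
  have I01: "0 \<le> I p q" for p q by (auto simp: I_def split: prod.splits)
  have I_sym: "I p q = I q p" if "p \<in> V \<times> V" "q \<in> V \<times> V" for p q
    using that in_nbrs_sym by (auto simp: I_def split: prod.splits)
  have I_sum: "(\<Sum>q\<in>V\<times>V. I p q) \<le> s * dg (fst p)" if p: "p \<in> V \<times> V" for p
  proof -
    obtain x y where xy: "p = (x, y)" "x \<in> V" "y \<in> V" using p by auto
    have "(\<Sum>q\<in>V\<times>V. I p q) = (\<Sum>z\<in>V. \<Sum>t\<in>V. I p (z, t))"
      by (simp add: sum.cartesian_product split_def)
    \<comment> \<open>\<open>t\<close> is chosen first, among the \<open>dg x\<close> neighbours of
      \<open>x\<close>; the colour of that edge then leaves at most \<open>s\<close> choices of
      \<open>z\<close>.\<close>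
    also have "\<dots> = (\<Sum>t\<in>V. \<Sum>z\<in>V. I p (z, t))" by (rule sum.swap)
    also have "\<dots> = (\<Sum>t\<in>V. if t \<in> nbrs x then \<Sum>z\<in>V. if z \<in> nbrs y \<and> \<phi> y z = \<phi> t x then 1 else 0 else 0)"
      by (intro sum.cong refl) (auto simp: I_def xy)
    also have "\<dots> = (\<Sum>t\<in>nbrs x. \<Sum>z\<in>V. if z \<in> nbrs y \<and> \<phi> y z = \<phi> t x then 1 else 0)"
      using nbrs_sub finite_V by (simp add: sum.If_cases Int_absorb1)
    also have "\<dots> = (\<Sum>t\<in>nbrs x. real (card {z \<in> nbrs y. \<phi> y z = \<phi> t x}))"
    proof (intro sum.cong refl)
      fix t
      have "V \<inter> {z. z \<in> nbrs y \<and> \<phi> y z = \<phi> t x} = {z \<in> nbrs y. \<phi> y z = \<phi> t x}"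
        using nbrs_sub by auto
      then show "(\<Sum>z\<in>V. if z \<in> nbrs y \<and> \<phi> y z = \<phi> t x then 1 else 0)
          = real (card {z \<in> nbrs y. \<phi> y z = \<phi> t x})"
        using finite_V by (simp add: sum.If_cases)
    qed
    also have "\<dots> \<le> (\<Sum>t\<in>nbrs x. s)" using s xy by (intro sum_mono) auto
    also have "\<dots> = s * dg (fst p)" by (simp add: dg_def xy)
    finally show ?thesis .
  qed
  have "sum wt X = sum h (f ` X)"
    using inj f by (simp add: sum.reindex)
  also have "\<dots> \<le> sum h (walks j \<times> walks j)"
  proof (rule sum_mono2)
    show "f ` X \<subseteq> walks j \<times> walks j" using f by blast
    show "0 \<le> h b" for b using I01 by (auto simp: h_def split: prod.splits)
  qed simp
  also have "\<dots> = (\<Sum>P\<in>walks j. wt P * (\<Sum>Q\<in>walks j. wt Q * I (e P) (e Q)))"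
    by (simp add: h_def sum.cartesian_product sum_distrib_left mult.assoc)
  also have "\<dots> = (\<Sum>P\<in>walks j. wt P * (\<Sum>q\<in>V\<times>V. L q * I (e P) q))"
    unfolding e_def sum_walks_ends[of "\<lambda>z t. I p (z, t)" j for p]
    by (simp add: L_def sum.cartesian_product split_def)
  also have "\<dots> = (\<Sum>p\<in>V\<times>V. L p * (\<Sum>q\<in>V\<times>V. L q * I p q))"
    unfolding e_def sum_walks_ends[of "\<lambda>x y. \<Sum>q\<in>V\<times>V. L q * I (x, y) q" j]
    by (simp add: L_def sum.cartesian_product split_def)
  also have "\<dots> = (\<Sum>p\<in>V\<times>V. \<Sum>q\<in>V\<times>V. I p q * (L p * L q))"
    by (simp add: sum_distrib_left mult_ac)
  also have "\<dots> \<le> (\<Sum>p\<in>V\<times>V. \<Sum>q\<in>V\<times>V. I p q * ((L p)\<^sup>2 / 2 + (L q)\<^sup>2 / 2))"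
  proof (intro sum_mono mult_left_mono I01)
    fix p q show "L p * L q \<le> (L p)\<^sup>2 / 2 + (L q)\<^sup>2 / 2"
      using zero_le_power2[of "L p - L q"] by (simp add: power2_diff)
  qed
  also have "\<dots> = (\<Sum>p\<in>V\<times>V. \<Sum>q\<in>V\<times>V. I p q * ((L p)\<^sup>2 / 2))
      + (\<Sum>p\<in>V\<times>V. \<Sum>q\<in>V\<times>V. I p q * ((L q)\<^sup>2 / 2))"
    by (simp add: distrib_left sum.distrib)
  also have "(\<Sum>p\<in>V\<times>V. \<Sum>q\<in>V\<times>V. I p q * ((L q)\<^sup>2 / 2)) = (\<Sum>p\<in>V\<times>V. \<Sum>q\<in>V\<times>V. I p q * ((L p)\<^sup>2 / 2))"
  proof (subst sum.swap, intro sum.cong refl)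
    fix p q assume "p \<in> V \<times> V" "q \<in> V \<times> V"
    then show "I p q * ((L q)\<^sup>2 / 2) = I q p * ((L q)\<^sup>2 / 2)" using I_sym by simp
  qed
  also have "(\<Sum>p\<in>V\<times>V. \<Sum>q\<in>V\<times>V. I p q * ((L p)\<^sup>2 / 2)) + (\<Sum>p\<in>V\<times>V. \<Sum>q\<in>V\<times>V. I p q * ((L p)\<^sup>2 / 2))
      = (\<Sum>p\<in>V\<times>V. (L p)\<^sup>2 * (\<Sum>q\<in>V\<times>V. I p q))"
    by (simp add: sum_distrib_left mult_ac flip: sum.distrib)
  also have "\<dots> \<le> (\<Sum>p\<in>V\<times>V. (L p)\<^sup>2 * (s * dg (fst p)))"
    using I_sum by (intro sum_mono mult_left_mono) auto
  also have "\<dots> = (\<Sum>x\<in>V. \<Sum>y\<in>V. (K j x y)\<^sup>2 * (s * dg x))"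
    by (simp add: L_def sum.cartesian_product split_def)
  also have "\<dots> \<le> (\<Sum>x\<in>V. \<Sum>y\<in>V. s / \<delta> * (dg x * dg y * (K j x y)\<^sup>2))"
  proof (intro sum_mono)
    fix x y assume "y \<in> V"
    then have "1 \<le> dg y / \<delta>" using dg_ge min_degree_pos by simp
    then have "s * dg x * (K j x y)\<^sup>2 * 1 \<le> s * dg x * (K j x y)\<^sup>2 * (dg y / \<delta>)"
      using s0 by (intro mult_left_mono) auto
    then show "(K j x y)\<^sup>2 * (s * dg x) \<le> s / \<delta> * (dg x * dg y * (K j x y)\<^sup>2)"
      by (simp add: mult_ac)
  qed
  also have "\<dots> = s / \<delta> * T (2 * (k - 1))"
    unfolding T_double by (simp add: sum_distrib_left j)
  finally show ?thesis .
qed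

text \<open>Rotation maps the closed walks injectively into themselves and preserves
  \<open>wt\<close>.\<close>

lemma sum_wt_rotate_le:
  assumes "\<And>xs. xs \<in> closed_walks m \<Longrightarrow> C xs \<Longrightarrow> D (rotate i xs)"
  shows "(\<Sum>xs | xs \<in> closed_walks m \<and> C xs. wt xs) \<le> (\<Sum>xs | xs \<in> closed_walks m \<and> D xs. wt xs)"
proof -
  have inj: "inj_on (rotate i) A" for A :: "'v list set"
  proof (rule inj_onI)
    fix xs ys :: "'v list" assume "rotate i xs = rotate i ys"
    then show "xs = ys"
    proof (induction i)
      case (Suc i)
      have "inj (rotate1 :: 'v list \<Rightarrow> _)" by (rule inj_rotate1)
      then show ?case using Suc by (auto dest: injD)
    qed simp
  qed
  have "(\<Sum>xs | xs \<in> closed_walks m \<and> C xs. wt xs)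
      = (\<Sum>xs\<in>rotate i ` {xs \<in> closed_walks m. C xs}. wt xs)"
    using inj by (simp add: sum.reindex wt_rotate)
  also have "\<dots> \<le> (\<Sum>xs | xs \<in> closed_walks m \<and> D xs. wt xs)"
    using assms rotate_closed_walk by (intro sum_mono2) auto
  finally show ?thesis .
qed

text \<open>A cyclic conflict between two positions can be rotated so that one of them is \<open>0\<close>
  and the other one lies in the first half of the walk.\<close>

lemma sum_wt_conflict_pair:
  assumes base: "\<And>a. 1 \<le> a \<Longrightarrow> a \<le> k \<Longrightarrow> (\<Sum>xs | xs \<in> closed_walks (2 * k) \<and> C xs 0 a. wt xs) \<le> b"
    and sym: "\<And>xs i j. C xs i j \<Longrightarrow> C xs j i"
    and rot: "\<And>xs i a. xs \<in> closed_walks (2 * k) \<Longrightarrow> i < 2 * k \<Longrightarrow> a < 2 * k \<Longrightarrow>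
      C xs i ((i + a) mod (2 * k)) \<Longrightarrow> C (rotate i xs) 0 a"
    and ij: "i < 2 * k" "j < 2 * k" "i \<noteq> j"
  shows "(\<Sum>xs | xs \<in> closed_walks (2 * k) \<and> C xs i j. wt xs) \<le> b"
proof -
  have main: "(\<Sum>xs | xs \<in> closed_walks (2 * k) \<and> C xs i ((i + a) mod (2 * k)). wt xs) \<le> b"
    if "i < 2 * k" "1 \<le> a" "a \<le> k" for i a
  proof -
    have "(\<Sum>xs | xs \<in> closed_walks (2 * k) \<and> C xs i ((i + a) mod (2 * k)). wt xs)
      \<le> (\<Sum>xs | xs \<in> closed_walks (2 * k) \<and> C xs 0 a. wt xs)"
      using that rot by (intro sum_wt_rotate_le[where i = i]) auto
    then show ?thesis using base that by fastforce
  qed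
  have *: "(\<Sum>xs | xs \<in> closed_walks (2 * k) \<and> C xs i j. wt xs) \<le> b"
    if ij: "i < 2 * k" "j < 2 * k" "i < j" for i j
  proof (cases "j - i \<le> k")
    case True
    then show ?thesis using main[of i "j - i"] ij by simp
  next
    case False
    \<comment> \<open>When \<open>j\<close> is more than half way round from \<open>i\<close>, the
      way from \<open>j\<close> on to \<open>i\<close> across the end of the list is the short
      one.\<close>
    have "(j + (2 * k - (j - i))) mod (2 * k) = i"
      using ij by (simp add: mod_if)
    then have "(\<Sum>xs | xs \<in> closed_walks (2 * k) \<and> C xs j i. wt xs) \<le> b"
      using main[of j "2 * k - (j - i)"] ij False by simp
    moreover have "C xs i j = C xs j i" for xs using sym by blast
    ultimately show ?thesis by simp
  qed
  have eq: "C xs i j = C xs j i" for xs using sym by blast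
  show ?thesis
  proof (cases "i < j")
    case True then show ?thesis using * ij by blast
  next
    case False then show ?thesis using *[of j i] ij by (simp add: eq)
  qed
qed

lemma sum_wt_UN_le:
  assumes "finite J" "\<And>p. p \<in> J \<Longrightarrow> finite (A p)" "\<And>p. p \<in> J \<Longrightarrow> sum wt (A p) \<le> b"
  shows "sum wt (\<Union>p\<in>J. A p) \<le> real (card J) * b"
  using assms
proof (induction J rule: finite_induct)
  case (insert p J)
  have "sum wt (\<Union>p\<in>insert p J. A p) \<le> sum wt (A p) + sum wt (\<Union>p\<in>J. A p)"
    using insert by (simp add: sum_Un sum_nonneg)
  also have "\<dots> \<le> b + real (card J) * b" using insert by (intro add_mono) auto
  finally show ?case using insert by (simp add: distrib_right)
qed simp

text \<open>A union bound over the ordered pairs of positions: vertex conflicts and colour conflicts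
  together carry at most half of \<open>T (2 * k)\<close>, while all closed walks carry at least
  \<open>T (2 * k)\<close>.\<close>

lemma exists_conflict_free_closed_walk:
  fixes R :: "'v \<Rightarrow> 'v \<Rightarrow> bool" and \<phi> :: "'v \<Rightarrow> 'v \<Rightarrow> 'c"
  assumes k: "1 \<le> k" and r: "0 \<le> r" "real (card V) \<le> r ^ k"
    and R_sym: "\<And>x y. R x y \<Longrightarrow> R y x"
    and R: "\<And>u v. u \<in> V \<Longrightarrow> v \<in> V \<Longrightarrow> real (card {w \<in> V. adj u w \<and> R w v}) \<le> s"
    and \<phi>_sym: "\<And>x y. \<phi> x y = \<phi> y x"
    and \<phi>: "\<And>u c. u \<in> V \<Longrightarrow> real (card {w \<in> V. adj u w \<and> \<phi> u w = c}) \<le> s"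
    and s0: "0 \<le> s"
    and \<delta>: "256 * real k ^ 4 * s * r \<le> \<delta>"
  shows "\<exists>xs\<in>closed_walks (2 * k). \<forall>i<2 * k. \<forall>j<2 * k. i \<noteq> j \<longrightarrow> \<not> R (xs ! i) (xs ! j) \<and>
    \<phi> (xs ! i) (xs ! (Suc i mod (2 * k))) \<noteq> \<phi> (xs ! j) (xs ! (Suc j mod (2 * k)))"
proof (rule ccontr)
  assume none: "\<not> ?thesis"
  \<comment> \<open>Fewer than \<open>4 * k^2\<close> ordered pairs with two kinds of conflict, each
    of weight at most \<open>\<rho> * T (2 * k)\<close>, then add up to at most
    \<open>T (2 * k) / 2\<close>.\<close>
  define \<rho> where "\<rho> = 1 / (16 * real k ^ 2)"
  define e where "e xs i = \<phi> (xs ! i) (xs ! (Suc i mod (2 * k)))" for xs i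
  have k0: "0 < real k" using k by simp
  have "1 \<le> real k ^ 2" using k by simp
  then have "1 \<le> 16 * real k ^ 2" by linarith
  then have \<rho>: "0 < \<rho>" "\<rho> \<le> 1" using k0 unfolding \<rho>_def by simp_all
  \<comment> \<open>The factor \<open>256 * k^4\<close> in the degree hypothesis is
    \<open>1 / \<rho>^2\<close>.\<close>
  have sr: "s * r / \<delta> \<le> \<rho>\<^sup>2"
    using \<delta> min_degree_pos k0 by (simp add: \<rho>_def field_simps)
  have T1: "1 \<le> T (2 * k)" by (rule T_double_ge_1)
  have "s / \<delta> * T (2 * (k - 1)) \<le> s / \<delta> * (r * T (2 * k))"
    using T_pred_le[OF k r(2,1)] s0 min_degree_pos by (intro mult_left_mono) auto
  also have "\<dots> = s * r / \<delta> * T (2 * k)" by simp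
  also have "\<dots> \<le> \<rho>\<^sup>2 * T (2 * k)" using sr T1 by (intro mult_right_mono) auto
  finally have small: "s / \<delta> * T (2 * (k - 1)) \<le> \<rho>\<^sup>2 * T (2 * k)" .
  have "s / (\<rho> * \<delta>) * T (2 * (k - 1)) = s / \<delta> * T (2 * (k - 1)) / \<rho>" by simp
  also have "\<dots> \<le> \<rho>\<^sup>2 * T (2 * k) / \<rho>" using small \<rho> by (intro divide_right_mono) auto
  also have "\<dots> = \<rho> * T (2 * k)" using \<rho> by (simp add: power2_eq_square)
  finally have bound1: "(\<rho> * T (2 * k) + s / (\<rho> * \<delta>) * T (2 * (k - 1))) / 2 \<le> \<rho> * T (2 * k)"
    by simp
  have bound2: "s / \<delta> * T (2 * (k - 1)) \<le> \<rho> * T (2 * k)"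
  proof -
    have "\<rho>\<^sup>2 * T (2 * k) \<le> \<rho> * T (2 * k)"
      using \<rho> T1 by (intro mult_right_mono) (auto simp: power2_eq_square mult_left_le)
    then show ?thesis using small by linarith
  qed
  have R': "real (card {w \<in> nbrs u. R w v}) \<le> s" if "u \<in> V" "v \<in> V" for u v
    using R[OF that] by (simp add: nbrs_def conj_assoc)
  have \<phi>': "real (card {w \<in> nbrs u. \<phi> u w = c}) \<le> s" if "u \<in> V" for u c
    using \<phi>[OF that] by (simp add: nbrs_def conj_assoc)
  have vertex: "(\<Sum>xs | xs \<in> closed_walks (2 * k) \<and> R (xs ! i) (xs ! j). wt xs) \<le> \<rho> * T (2 * k)"
    if "i < 2 * k" "j < 2 * k" "i \<noteq> j" for i j
  proof (rule sum_wt_conflict_pair[where C = "\<lambda>xs i j. R (xs ! i) (xs ! j)", OF _ _ _ that])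
    fix a assume a: "1 \<le> a" "a \<le> k"
    have "(\<Sum>xs | xs \<in> closed_walks (2 * k) \<and> R (xs ! 0) (xs ! a). wt xs)
      \<le> (\<rho> * T (2 * k) + s / (\<rho> * \<delta>) * T (2 * (k - 1))) / 2"
    \<comment> \<open>\<open>P\<close> starts at position 1 of the walk, so position
      \<open>a\<close> is entry \<open>a - 1\<close> of \<open>P\<close>.\<close>
    proof (rule sum_wt_conflict_path[where B = "\<lambda>x P. R x (P ! (a - 1))"])
      fix P assume "P \<in> walks (k - 1)"
      then have "hd P \<in> V" "P ! (a - 1) \<in> V"
        using walks_ends[of P "k - 1"] a k by (auto simp: walks_def)
      then show "real (card {x \<in> nbrs (hd P). R x (P ! (a - 1))}) \<le> s" by (rule R')
    next
      fix xs assume xs: "xs \<in> {xs. xs \<in> closed_walks (2 * k) \<and> R (xs ! 0) (xs ! a)}"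
      then have "length xs = 2 * k" by (auto simp: closed_walks_def)
      then show "R (hd xs) (take k (tl xs) ! (a - 1))"
        using xs a k by (cases xs) (auto simp: nth_Cons')
    qed (use k \<rho> s0 in auto)
    then show "(\<Sum>xs | xs \<in> closed_walks (2 * k) \<and> R (xs ! 0) (xs ! a). wt xs) \<le> \<rho> * T (2 * k)"
      using bound1 by linarith
  next
    fix xs i a assume "xs \<in> closed_walks (2 * k)" "i < 2 * k" "a < 2 * k" "R (xs ! i) (xs ! ((i + a) mod (2 * k)))"
    then show "R (rotate i xs ! 0) (rotate i xs ! a)"
      by (auto simp: closed_walks_def nth_rotate)
  qed (fact R_sym)
  have rot_e: "e (rotate i xs) a = e xs ((i + a) mod (2 * k))"
    if "xs \<in> closed_walks (2 * k)" "a < 2 * k" for xs i a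
  proof -
    have "(i + Suc a mod (2 * k)) mod (2 * k) = Suc ((i + a) mod (2 * k)) mod (2 * k)"
      by (simp add: mod_simps)
    then show ?thesis using that by (auto simp: e_def closed_walks_def nth_rotate)
  qed
  have colour: "(\<Sum>xs | xs \<in> closed_walks (2 * k) \<and> e xs i = e xs j. wt xs) \<le> \<rho> * T (2 * k)"
    if "i < 2 * k" "j < 2 * k" "i \<noteq> j" for i j
  proof (rule sum_wt_conflict_pair[where C = "\<lambda>xs i j. e xs i = e xs j", OF _ _ _ that])
    fix a assume a: "1 \<le> a" "a \<le> k"
    show "(\<Sum>xs | xs \<in> closed_walks (2 * k) \<and> e xs 0 = e xs a. wt xs) \<le> \<rho> * T (2 * k)"
    proof (cases "a < k")
      case True
      have "(\<Sum>xs | xs \<in> closed_walks (2 * k) \<and> e xs 0 = e xs a. wt xs)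
        \<le> (\<rho> * T (2 * k) + s / (\<rho> * \<delta>) * T (2 * (k - 1))) / 2"
      \<comment> \<open>For \<open>a < k\<close> both ends of edge \<open>a\<close> lie in
        \<open>P\<close>, so \<open>P\<close> fixes its colour.\<close>
      proof (rule sum_wt_conflict_path[where B = "\<lambda>x P. \<phi> (hd P) x = \<phi> (P ! (a - 1)) (P ! a)"])
        fix P assume "P \<in> walks (k - 1)"
        then have "hd P \<in> V" using walks_ends by auto
        then show "real (card {x \<in> nbrs (hd P). \<phi> (hd P) x = \<phi> (P ! (a - 1)) (P ! a)}) \<le> s"
          by (rule \<phi>')
      next
        fix xs assume xs: "xs \<in> {xs. xs \<in> closed_walks (2 * k) \<and> e xs 0 = e xs a}"
        then have len: "length xs = 2 * k" by (auto simp: closed_walks_def)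
        let ?P = "take k (tl xs)"
        have nth: "?P ! i = xs ! Suc i" if "i < k" for i
          using that len k by (simp add: nth_tl)
        have "hd ?P = xs ! 1" using nth[of 0] len k by (subst hd_conv_nth) (auto simp flip: length_greater_0_conv)
        moreover have "hd xs = xs ! 0" using len k by (subst hd_conv_nth) auto
        moreover have "?P ! (a - 1) = xs ! a" "?P ! a = xs ! Suc a" using nth a True by auto
        moreover have "Suc 0 mod (2 * k) = 1" "Suc a mod (2 * k) = Suc a" using True k by auto
        moreover have "e xs 0 = e xs a" using xs by simp
        ultimately show "\<phi> (hd ?P) (hd xs) = \<phi> (?P ! (a - 1)) (?P ! a)"
          by (simp add: e_def \<phi>_sym[of "xs ! Suc 0" "xs ! 0"])
      qed (use k \<rho> s0 in auto)
      then show ?thesis using bound1 by linarith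
    next
      case False
      then have ak: "a = k" using a by simp
      \<comment> \<open>Rotating by one turns the opposite edges \<open>0\<close> and
        \<open>k\<close> into the edges \<open>k - 1\<close> and \<open>2 * k - 1\<close>, which
        join the two halves of the list.\<close>
      have "(\<Sum>xs | xs \<in> closed_walks (2 * k) \<and> e xs 0 = e xs a. wt xs)
        \<le> (\<Sum>xs | xs \<in> closed_walks (2 * k) \<and> e xs (k - 1) = e xs (2 * k - 1). wt xs)"
      proof (rule sum_wt_rotate_le[where i = 1 and C = "\<lambda>xs. e xs 0 = e xs a"
            and D = "\<lambda>xs. e xs (k - 1) = e xs (2 * k - 1)"])
        fix xs assume xs: "xs \<in> closed_walks (2 * k)" "e xs 0 = e xs a"
        have "1 + (k - 1) = k" "1 + (2 * k - 1) = 2 * k" using k by linarith+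
        then have "(1 + (k - 1)) mod (2 * k) = k" "(1 + (2 * k - 1)) mod (2 * k) = 0"
          using k by (simp_all only: mod_self mod_less)
        moreover have "k - 1 < 2 * k" "2 * k - 1 < 2 * k" using k by auto
        ultimately show "e (rotate 1 xs) (k - 1) = e (rotate 1 xs) (2 * k - 1)"
          using xs(2) by (simp only: rot_e[OF xs(1)] ak)
      qed
      also have "\<dots> \<le> s / \<delta> * T (2 * (k - 1))"
      proof (rule sum_wt_conflict_antipodal[where \<phi> = \<phi>])
        fix xs assume "xs \<in> {xs. xs \<in> closed_walks (2 * k) \<and> e xs (k - 1) = e xs (2 * k - 1)}"
        moreover have "Suc (k - 1) mod (2 * k) = k" "Suc (2 * k - 1) mod (2 * k) = 0" using k by auto
        ultimately show "\<phi> (xs ! (k - 1)) (xs ! k) = \<phi> (xs ! (2 * k - 1)) (xs ! 0)"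
          by (auto simp: e_def)
      qed (use k \<phi>' s0 in auto)
      also note bound2
      finally show ?thesis .
    qed
  next
    fix xs i a assume "xs \<in> closed_walks (2 * k)" "i < 2 * k" "a < 2 * k" "e xs i = e xs ((i + a) mod (2 * k))"
    then show "e (rotate i xs) 0 = e (rotate i xs) a" by (simp add: rot_e)
  qed (rule sym)
  define J where "J = ({..<2 * k} \<times> {..<2 * k}) - Id"
  define A where "A p = {xs \<in> closed_walks (2 * k). R (xs ! fst p) (xs ! snd p)}
    \<union> {xs \<in> closed_walks (2 * k). e xs (fst p) = e xs (snd p)}" for p
  have "sum wt (A p) \<le> 2 * (\<rho> * T (2 * k))" if "p \<in> J" for p
  proof -
    have "sum wt (A p) \<le> (\<Sum>xs | xs \<in> closed_walks (2 * k) \<and> R (xs ! fst p) (xs ! snd p). wt xs)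
       + (\<Sum>xs | xs \<in> closed_walks (2 * k) \<and> e xs (fst p) = e xs (snd p). wt xs)"
      unfolding A_def by (simp add: sum_Un sum_nonneg)
    also have "\<dots> \<le> \<rho> * T (2 * k) + \<rho> * T (2 * k)"
      using that by (intro add_mono vertex colour) (auto simp: J_def)
    finally show ?thesis by simp
  qed
  then have union: "sum wt (\<Union>p\<in>J. A p) \<le> real (card J) * (2 * (\<rho> * T (2 * k)))"
    by (intro sum_wt_UN_le) (simp_all add: J_def A_def)
  have "closed_walks (2 * k) \<subseteq> (\<Union>p\<in>J. A p)"
  proof
    fix xs assume xs: "xs \<in> closed_walks (2 * k)"
    then obtain i j where "i < 2 * k" "j < 2 * k" "i \<noteq> j" "R (xs ! i) (xs ! j) \<or> e xs i = e xs j"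
      using none unfolding e_def by blast
    then have "(i, j) \<in> J" "xs \<in> A (i, j)" using xs by (auto simp: J_def A_def)
    then show "xs \<in> (\<Union>p\<in>J. A p)" by (rule UN_I)
  qed
  then have "sum wt (closed_walks (2 * k)) \<le> sum wt (\<Union>p\<in>J. A p)"
    by (rule sum_mono2[rotated]) (simp_all add: J_def A_def)
  then have "T (2 * k) \<le> sum wt (\<Union>p\<in>J. A p)"
    using T_le_closed_walks[of "2 * k"] k by simp
  also note union
  also have "real (card J) * (2 * (\<rho> * T (2 * k))) \<le> real (4 * k\<^sup>2) * (2 * (\<rho> * T (2 * k)))"
  proof (intro mult_right_mono)
    have "card J \<le> card ({..<2 * k} \<times> {..<2 * k})" unfolding J_def by (intro card_mono) auto
    then show "real (card J) \<le> real (4 * k\<^sup>2)"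
      by (simp add: card_cartesian_product power2_eq_square del: of_nat_mult of_nat_power)
  qed (use \<rho> T1 in auto)
  also have "\<dots> = T (2 * k) / 2" using k0 by (simp add: \<rho>_def)
  finally show False using T1 by simp
qed

end

section \<open>Pairs of edges of the same colour\<close>

text \<open>Deleting a vertex of degree below \<open>m\<close> lowers the degree sum by less than
  \<open>2 * m\<close>, once at the vertex and once at its neighbours, so the average stays at least
  \<open>2 * m\<close>.\<close>

lemma exists_min_degree_subset:
  fixes adj :: "'v \<Rightarrow> 'v \<Rightarrow> bool" and m :: real
  assumes "finite V" "V \<noteq> {}" "0 < m"
    and sym: "\<And>x y. adj x y \<Longrightarrow> adj y x"
    and "2 * m * real (card V) \<le> (\<Sum>x\<in>V. real (card {y \<in> V. adj x y}))"
  shows "\<exists>W\<subseteq>V. W \<noteq> {} \<and> (\<forall>x\<in>W. m \<le> real (card {y \<in> W. adj x y}))"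
  using assms(1,2,5)
proof (induction V rule: finite_psubset_induct)
  case (psubset V)
  show ?case
  proof (cases "\<forall>x\<in>V. m \<le> real (card {y \<in> V. adj x y})")
    case False
    then obtain x where x: "x \<in> V" and low: "real (card {y \<in> V. adj x y}) < m" by force
    let ?V = "V - {x}"
    have step: "real (card {z \<in> V. adj y z}) = real (card {z \<in> ?V. adj y z}) + (if adj x y then 1 else 0)"
      for y
    proof (cases "adj x y")
      case True
      then have "{z \<in> V. adj y z} = insert x {z \<in> ?V. adj y z}" using x sym by auto
      then show ?thesis using True psubset.hyps(1) by simp
    next
      case False
      then have "{z \<in> V. adj y z} = {z \<in> ?V. adj y z}" using sym by auto
      then show ?thesis using False by simp
    qed
    have "(\<Sum>y\<in>?V. if adj x y then 1 else 0) = real (card {y \<in> ?V. adj x y})"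
      using psubset.hyps(1) by (simp add: sum.If_cases Int_def)
    also have "\<dots> \<le> real (card {y \<in> V. adj x y})"
      using psubset.hyps(1) by (simp add: card_mono Collect_mono subset_eq)
    finally have lost: "(\<Sum>y\<in>?V. if adj x y then 1 else 0) \<le> real (card {y \<in> V. adj x y})" .
    have "(\<Sum>y\<in>V. real (card {z \<in> V. adj y z}))
        = real (card {y \<in> V. adj x y}) + (\<Sum>y\<in>?V. real (card {z \<in> V. adj y z}))"
      using x psubset.hyps(1) by (simp add: sum.remove)
    also have "(\<Sum>y\<in>?V. real (card {z \<in> V. adj y z})) =
        (\<Sum>y\<in>?V. real (card {z \<in> ?V. adj y z})) + (\<Sum>y\<in>?V. if adj x y then 1 else 0)"
      by (subst step) (rule sum.distrib)
    finally have total: "2 * m * real (card V) < 2 * m + (\<Sum>y\<in>?V. real (card {z \<in> ?V. adj y z}))"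
      using psubset.prems(2) lost low by linarith
    have card: "real (card V) = real (card ?V) + 1"
      using x psubset.hyps(1) card_Suc_Diff1[OF psubset.hyps(1) x] by linarith
    have "2 * m * real (card ?V) \<le> (\<Sum>y\<in>?V. real (card {z \<in> ?V. adj y z}))"
      using total unfolding card by (simp add: distrib_left)
    \<comment> \<open>If the deleted vertex were the only one, \<open>total\<close> would read
      \<open>2 * m < 2 * m\<close>.\<close>
    moreover have "?V \<noteq> {}"
    proof
      assume "?V = {}"
      with total card show False by (simp only: card.empty sum.empty) simp
    qed
    moreover have "?V \<subset> V" using x by auto
    ultimately obtain W where "W \<subseteq> ?V" "W \<noteq> {}" "\<forall>x\<in>W. m \<le> real (card {y \<in> W. adj x y})"
      using psubset.IH[of ?V] by blast
    then show ?thesis by blast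
  qed (use psubset.prems in blast)
qed

section \<open>The auxiliary graph on pairs of vertices\<close>

definition twin_adj :: "'a set set \<Rightarrow> ('a set \<Rightarrow> 'b) \<Rightarrow> 'a \<times> 'a \<Rightarrow> 'a \<times> 'a \<Rightarrow> bool" where
  "twin_adj E c p q \<longleftrightarrow> {fst p, fst q} \<in> E \<and> {snd p, snd q} \<in> E \<and>
     {fst p, fst q} \<noteq> {snd p, snd q} \<and> c {fst p, fst q} = c {snd p, snd q}"

lemma twin_adj_sym: "twin_adj E c p q \<Longrightarrow> twin_adj E c q p"
  by (auto simp: twin_adj_def insert_commute)

text \<open>Under a proper colouring, distinct edges of the same colour are disjoint.\<close>

lemma twin_adj_fst_neq_snd:
  assumes "proper_edge_colouring E c" "twin_adj E c p q"
  shows "fst p \<noteq> snd p"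
  using assms unfolding twin_adj_def proper_edge_colouring_def by (metis disjoint_insert(1) insertI1)

lemma proper_edge_colouring_neighbour_eq:
  assumes "proper_edge_colouring E c" "{u, v} \<in> E" "{u, w} \<in> E" "c {u, v} = c {u, w}"
  shows "v = w"
proof -
  have "{u, v} = {u, w}"
    using assms unfolding proper_edge_colouring_def by (metis disjoint_insert(1) insertI1)
  then show ?thesis by (auto simp: doubleton_eq_iff)
qed

text \<open>Either coordinate of \<open>q\<close> fixes the common colour, and this colour fixes the
  edge at each coordinate of \<open>p\<close>.\<close>

lemma twin_adj_unique:
  assumes "proper_edge_colouring E c" "twin_adj E c p q" "twin_adj E c p q'"
    and "fst q = fst q' \<or> snd q = snd q' \<or> c {fst p, fst q} = c {fst p, fst q'}"
  shows "q = q'"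
proof -
  have "c {fst p, fst q} = c {fst p, fst q'}"
    using assms by (metis twin_adj_def)
  then have "fst q = fst q'" "snd q = snd q'"
    using assms by (metis proper_edge_colouring_neighbour_eq twin_adj_def)+
  then show ?thesis by (simp add: prod_eq_iff)
qed

lemma card_le_one_if_unique:
  assumes "\<And>x y. x \<in> A \<Longrightarrow> y \<in> A \<Longrightarrow> x = y"
  shows "card A \<le> 1"
proof (cases "A = {}")
  case False
  then obtain x where "A = {x}" using assms by blast
  then show ?thesis by simp
qed simp

lemma card_twin_adj_colour:
  assumes "proper_edge_colouring E c"
  shows "card {q \<in> W. twin_adj E c p q \<and> c {fst p, fst q} = a} \<le> 1"
proof (intro card_le_one_if_unique)
  fix x y assume "x \<in> {q \<in> W. twin_adj E c p q \<and> c {fst p, fst q} = a}"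
    "y \<in> {q \<in> W. twin_adj E c p q \<and> c {fst p, fst q} = a}"
  then show "x = y" by (intro twin_adj_unique[OF assms, of p]) simp_all
qed

text \<open>There are four ways for a coordinate of \<open>q\<close> to equal a coordinate of
  \<open>v\<close>, and each leaves at most one \<open>q\<close>.\<close>

lemma card_twin_adj_meet:
  assumes "proper_edge_colouring E c"
  shows "card {q \<in> W. twin_adj E c p q \<and> {fst q, snd q} \<inter> {fst v, snd v} \<noteq> {}} \<le> 4"
proof -
  define F where "F a = {q \<in> W. twin_adj E c p q \<and> fst q = a}" for a
  define S where "S a = {q \<in> W. twin_adj E c p q \<and> snd q = a}" for a
  have F: "card (F a) \<le> 1" and S: "card (S a) \<le> 1" for a
    unfolding F_def S_def
    by (intro card_le_one_if_unique; rule twin_adj_unique[OF assms, of p]; simp)+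
  have "{q \<in> W. twin_adj E c p q \<and> {fst q, snd q} \<inter> {fst v, snd v} \<noteq> {}}
    = (F (fst v) \<union> F (snd v)) \<union> (S (fst v) \<union> S (snd v))"
    by (auto simp: F_def S_def)
  also have "card \<dots> \<le> card (F (fst v) \<union> F (snd v)) + card (S (fst v) \<union> S (snd v))" by (rule card_Un_le)
  also have "\<dots> \<le> (card (F (fst v)) + card (F (snd v))) + (card (S (fst v)) + card (S (snd v)))"
    by (intro add_mono card_Un_le)
  also have "\<dots> \<le> 4" using F[of "fst v"] F[of "snd v"] S[of "fst v"] S[of "snd v"] by linarith
  finally show ?thesis .
qed

text \<open>Cauchy-Schwarz over the colour classes bounds the number of ordered pairs of edges of
  equal colour from below; the pairs \<open>(e, e)\<close> account for the subtracted
  \<open>card E\<close>.\<close>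

lemma sum_twin_degrees_ge:
  assumes G: "simple_graph V E" and n: "card (c ` E) \<le> n" "0 < n"
  shows "real (card E) ^ 2 / real n - real (card E)
    \<le> (\<Sum>p\<in>V \<times> V. real (card {q \<in> V \<times> V. twin_adj E c p q}))"
proof -
  have finV: "finite V" and E: "\<And>e. e \<in> E \<Longrightarrow> e \<subseteq> V \<and> card e = 2"
    using G by (auto simp: simple_graph_def)
  then have finE: "finite E" by (intro finite_subset[of E "Pow V"]) auto
  define N where "N a = {e \<in> E. c e = a}" for a
  have cardE: "real (card E) = (\<Sum>a\<in>c ` E. real (card (N a)))"
    using sum.group[OF finE, of "c ` E" c "\<lambda>_. 1 :: real"] finE by (simp add: N_def)
  define S where "S = {(e, f) \<in> E \<times> E. c e = c f}"
  have S_eq: "S = (\<Union>a\<in>c ` E. N a \<times> N a)" by (auto simp: S_def N_def)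
  have "card S = (\<Sum>a\<in>c ` E. card (N a \<times> N a))"
    unfolding S_eq using finE by (intro card_UN_disjoint) (auto simp: N_def)
  then have cardS: "real (card S) = (\<Sum>a\<in>c ` E. (real (card (N a)))\<^sup>2)"
    by (simp add: card_cartesian_product power2_eq_square)
  have "(real (card E))\<^sup>2 \<le> real (card (c ` E)) * real (card S)"
    using Cauchy_Schwarz_ineq_sum[of "\<lambda>_. 1" "\<lambda>a. real (card (N a))" "c ` E"]
    by (simp add: cardE cardS)
  also have "\<dots> \<le> real n * real (card S)" using n by (intro mult_right_mono) auto
  finally have S_ge: "(real (card E))\<^sup>2 / real n \<le> real (card S)"
    using n(2) by (simp add: divide_simps mult.commute)
  define D where "D = (SIGMA p:V \<times> V. {q \<in> V \<times> V. twin_adj E c p q})"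
  have finD: "finite D" using finV by (simp add: D_def)
  have cardD: "real (card D) = (\<Sum>p\<in>V \<times> V. real (card {q \<in> V \<times> V. twin_adj E c p q}))"
    unfolding D_def using finV by (subst card_SigmaI) auto
  let ?f = "\<lambda>(p, q). ({fst p, fst q}, {snd p, snd q})"
  let ?diag = "(\<lambda>e. (e, e)) ` E"
  \<comment> \<open>One orientation of the two edges already gives an adjacency, which is enough for
    a lower bound.\<close>
  have "S - ?diag \<subseteq> ?f ` D"
  proof
    fix x assume "x \<in> S - ?diag"
    then obtain e f where x: "x = (e, f)" and ef: "e \<in> E" "f \<in> E" "c e = c f" "e \<noteq> f"
      by (auto simp: S_def)
    obtain u u' where e: "e = {u, u'}" using E[OF ef(1)] by (auto simp: card_2_iff)
    obtain v v' where f: "f = {v, v'}" using E[OF ef(2)] by (auto simp: card_2_iff)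
    have "((u, v), (u', v')) \<in> D"
      using ef E[OF ef(1)] E[OF ef(2)] by (auto simp: D_def twin_adj_def e f)
    then show "x \<in> ?f ` D" by (force simp: x e f)
  qed
  then have "card (S - ?diag) \<le> card D"
    by (meson card_image_le card_mono finD finite_imageI le_trans)
  moreover have "card S \<le> card (S - ?diag) + card ?diag"
    using diff_card_le_card_Diff[of ?diag S] finE by simp
  moreover have "card ?diag \<le> card E" using finE by (rule card_image_le)
  ultimately have "real (card S) \<le> real (card D) + real (card E)" by linarith
  then show ?thesis using S_ge cardD by linarith
qed

section \<open>Choice of parameters and extraction of the two cycles\<close>

theorem theorem4p1:
  fixes l :: nat
  assumes "l \<ge> 2"
  shows "\<exists>C::real. C > 0 \<and>
    (\<forall>(n::nat) (V :: 'a set) (E :: 'a set set) (c :: 'a set \<Rightarrow> 'b).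
       n \<ge> 1 \<longrightarrow>
       simple_graph V E \<longrightarrow>
       card V \<le> n \<longrightarrow>
       real (card E) \<ge> C * real n powr (3 / 2 + 1 / real l) \<longrightarrow>
       proper_edge_colouring E c \<longrightarrow>
       card (c ` E) \<le> n \<longrightarrow>
       (\<exists>p q. rainbow_cycle V E c p \<and> length p = 2 * l \<and>
              rainbow_cycle V E c q \<and> length q = 2 * l \<and>
              set p \<inter> set q = {} \<and>
              c ` cycle_edges p = c ` cycle_edges q))"
proof (rule exI[of _ "64 * real l ^ 2"], intro conjI allI impI)
  show "0 < 64 * real l ^ 2" using assms by simp
next
  fix n :: nat and V :: "'a set" and E :: "'a set set" and c :: "'a set \<Rightarrow> 'b"
  assume n: "1 \<le> n" and G: "simple_graph V E" and Vn: "card V \<le> n"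
    and En: "real (card E) \<ge> 64 * real l ^ 2 * real n powr (3 / 2 + 1 / real l)"
    and c: "proper_edge_colouring E c" and cn: "card (c ` E) \<le> n"
  \<comment> \<open>Chosen so that \<open>r ^ l\<close> is \<open>n\<close> squared, which bounds
    the number of pairs.\<close>
  define r where "r = real n powr (2 / real l)"
  \<comment> \<open>The threshold \<open>256 * l^4 * s * r\<close> at \<open>s = 4\<close>. As the
    square of \<open>64 * l^2\<close> is \<open>4 * 1024 * l^4\<close>, the edge bound squares to
    \<open>4 * m * n^3\<close>.\<close>
  define m where "m = 1024 * real l ^ 4 * r"
  have l0: "0 < real l" and n0: "0 < real n" using assms n by auto
  have r0: "0 < r" using n by (simp add: r_def)
  have m0: "0 < m" using r0 l0 by (simp add: m_def)
  have finV: "finite V" using G by (simp add: simple_graph_def)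
  have n_powr_pos: "0 < real n powr (3 / 2 + 1 / real l)" using n by simp
  have "real n powr 1 \<le> real n powr (3 / 2 + 1 / real l)"
    using n l0 by (intro powr_mono) (auto simp: add_increasing2)
  moreover have "1 \<le> real l ^ 2" using assms by simp
  ultimately have "2 * real n \<le> 64 * real l ^ 2 * real n powr (3 / 2 + 1 / real l)"
    using n0 by (intro mult_mono) auto
  \<comment> \<open>This makes the loss \<open>card E\<close> from the diagonal at most half of the
    Cauchy-Schwarz term.\<close>
  then have E2n: "2 * real n \<le> real (card E)" using En by linarith
  have "(64 * real l ^ 2 * real n powr (3 / 2 + 1 / real l))\<^sup>2 \<le> (real (card E))\<^sup>2"
    using En n_powr_pos by (intro power_mono) auto
  also have "(64 * real l ^ 2 * real n powr (3 / 2 + 1 / real l))\<^sup>2 = 4 * m * real n ^ 3"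
  proof -
    have "(real n powr (3 / 2 + 1 / real l))\<^sup>2 = real n powr (2 * (3 / 2 + 1 / real l))"
      by (simp only: power2_eq_square mult_2 powr_add)
    also have "2 * (3 / 2 + 1 / real l) = 2 / real l + 3" by simp
    also have "real n powr (2 / real l + 3) = r * real n ^ 3"
      using n0 by (simp add: powr_add r_def)
    finally show ?thesis by (simp add: power_mult_distrib m_def flip: power_mult)
  qed
  finally have Esq: "4 * m * real n ^ 3 \<le> (real (card E))\<^sup>2" .
  have "2 * m * real (card (V \<times> V)) \<le> 2 * m * (real n * real n)"
    using Vn m0 by (simp add: card_cartesian_product mult_mono)
  also have "\<dots> = 4 * m * real n ^ 3 / (2 * real n)"
    using n0 by (simp add: power3_eq_cube)
  also have "\<dots> \<le> (real (card E))\<^sup>2 / (2 * real n)"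
    using Esq n0 by (intro divide_right_mono) auto
  also have "\<dots> \<le> (real (card E))\<^sup>2 / real n - real (card E)"
  proof -
    have "2 * real n * real (card E) \<le> (real (card E))\<^sup>2"
      using mult_right_mono[OF E2n, of "real (card E)"] by (simp add: power2_eq_square)
    then show ?thesis using n0 by (simp add: field_simps)
  qed
  also have "\<dots> \<le> (\<Sum>p\<in>V \<times> V. real (card {q \<in> V \<times> V. twin_adj E c p q}))"
    using G cn n by (intro sum_twin_degrees_ge) auto
  finally have deg: "2 * m * real (card (V \<times> V)) \<le> \<dots>" .
  have "E \<noteq> {}" using E2n n0 by auto
  then have "V \<noteq> {}" using G by (auto simp: simple_graph_def)
  then obtain W where W: "W \<subseteq> V \<times> V" "W \<noteq> {}"
      "\<And>x. x \<in> W \<Longrightarrow> m \<le> real (card {y \<in> W. twin_adj E c x y})"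
    using exists_min_degree_subset[OF _ _ m0 twin_adj_sym deg] finV by auto
  interpret min_degree_graph W "twin_adj E c" m
  proof unfold_locales
    show "finite W" using W(1) finV by (auto intro: finite_subset)
    show "twin_adj E c q p" if "twin_adj E c p q" for p q using that by (rule twin_adj_sym)
  qed (fact W(3) m0 W(2))+
  have "real (card W) \<le> real (card (V \<times> V))" using W(1) finV by (intro of_nat_mono card_mono) auto
  also have "\<dots> \<le> real n * real n" using Vn by (simp add: card_cartesian_product mult_mono)
  also have "\<dots> = r ^ l"
  proof -
    have "r ^ l = real n powr (2 / real l * real l)"
      using r0 by (simp add: r_def powr_powr flip: powr_realpow)
    then show ?thesis using l0 n0 by (simp add: power2_eq_square)
  qed
  finally have cardW: "real (card W) \<le> r ^ l" .
  have "\<exists>xs\<in>closed_walks (2 * l). \<forall>i<2 * l. \<forall>j<2 * l. i \<noteq> j \<longrightarrow>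
    \<not> {fst (xs ! i), snd (xs ! i)} \<inter> {fst (xs ! j), snd (xs ! j)} \<noteq> {} \<and>
    c {fst (xs ! i), fst (xs ! (Suc i mod (2 * l)))} \<noteq> c {fst (xs ! j), fst (xs ! (Suc j mod (2 * l)))}"
  \<comment> \<open>\<open>s = 4\<close> comes from \<open>card_twin_adj_meet\<close>. The colour of
    a step is read off from the first coordinates; the second coordinates have the same one.\<close>
  proof (rule exists_conflict_free_closed_walk[where s = 4 and r = r
        and R = "\<lambda>p q. {fst p, snd p} \<inter> {fst q, snd q} \<noteq> {}" and \<phi> = "\<lambda>p q. c {fst p, fst q}"])
    show "real (card {w \<in> W. twin_adj E c u w \<and> {fst w, snd w} \<inter> {fst v, snd v} \<noteq> {}}) \<le> 4" for u v
      using card_twin_adj_meet[OF c, of W u v] by linarith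
    show "real (card {w \<in> W. twin_adj E c u w \<and> c {fst u, fst w} = a}) \<le> 4" for u a
      using card_twin_adj_colour[OF c, of W u a] by linarith
  qed (use assms r0 cardW in \<open>auto simp: m_def insert_commute\<close>)
  then obtain xs where xs: "xs \<in> closed_walks (2 * l)"
    and disj: "\<And>i j. i < 2 * l \<Longrightarrow> j < 2 * l \<Longrightarrow> i \<noteq> j \<Longrightarrow>
      {fst (xs ! i), snd (xs ! i)} \<inter> {fst (xs ! j), snd (xs ! j)} = {}"
    and rainbow: "\<And>i j. i < 2 * l \<Longrightarrow> j < 2 * l \<Longrightarrow> i \<noteq> j \<Longrightarrow>
      c {fst (xs ! i), fst (xs ! (Suc i mod (2 * l)))} \<noteq> c {fst (xs ! j), fst (xs ! (Suc j mod (2 * l)))}"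
    by auto
  have len: "length xs = 2 * l" and xsV: "set xs \<subseteq> V \<times> V"
    and twin: "\<And>i. i < 2 * l \<Longrightarrow> twin_adj E c (xs ! i) (xs ! (Suc i mod (2 * l)))"
    using xs W by (auto simp: closed_walks_def)
  define e where "e g i = {g (xs ! i), g (xs ! (Suc i mod (2 * l)))}" for g :: "'a \<times> 'a \<Rightarrow> 'a" and i
  have edges: "cycle_edges (map g xs) = e g ` {..<2 * l}" for g :: "'a \<times> 'a \<Rightarrow> 'a"
  proof -
    have "cycle_edges (map g xs) = (\<lambda>i. {map g xs ! i, map g xs ! (Suc i mod (2 * l))}) ` {..<2 * l}"
      unfolding cycle_edges_def image_def by (auto simp: len simp del: nth_map)
    also have "\<dots> = e g ` {..<2 * l}"
      using assms by (intro image_cong refl) (simp add: e_def len)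
    finally show ?thesis .
  qed
  have e: "e fst i \<in> E" "e snd i \<in> E" "c (e snd i) = c (e fst i)" if "i < 2 * l" for i
    using twin[OF that] by (auto simp: twin_adj_def e_def)
  have colours: "c ` e snd ` {..<2 * l} = c ` e fst ` {..<2 * l}"
    using e by (auto simp: image_image)
  have inj: "inj_on (c \<circ> e fst) {..<2 * l}"
    using rainbow by (intro inj_onI) (auto simp: e_def)
  \<comment> \<open>The two cycles have equal colours position by position, so the second inherits
    the rainbow property.\<close>
  have inj': "inj_on (c \<circ> e snd) {..<2 * l}"
    using inj e by (simp add: inj_on_def)
  have dist: "distinct (map fst xs)" "distinct (map snd xs)"
    unfolding distinct_conv_nth using disj by (auto simp: len)
  have "rainbow_cycle V E c (map fst xs)" "rainbow_cycle V E c (map snd xs)"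
    unfolding rainbow_cycle_def is_cycle_def edges
    using assms dist xsV e inj_on_imageI[OF inj] inj_on_imageI[OF inj'] by (auto simp: len)
  moreover have "set (map fst xs) \<inter> set (map snd xs) = {}"
  proof -
    \<comment> \<open>Different positions are separated by \<open>disj\<close>, equal ones by the
      disjointness of distinct edges of the same colour.\<close>
    have "fst (xs ! i) \<noteq> snd (xs ! j)" if "i < 2 * l" "j < 2 * l" for i j
      using disj[OF that] twin_adj_fst_neq_snd[OF c twin[OF that(1)]] by (cases "i = j") auto
    then show ?thesis by (force simp: in_set_conv_nth len)
  qed
  ultimately show "\<exists>p q. rainbow_cycle V E c p \<and> length p = 2 * l \<and>
      rainbow_cycle V E c q \<and> length q = 2 * l \<and> set p \<inter> set q = {} \<and>
      c ` cycle_edges p = c ` cycle_edges q"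
    by (intro exI[of _ "map fst xs"] exI[of _ "map snd xs"]) (simp add: edges colours len)
qed

end
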